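(* Let $(S_O,P_O)$ be a deductive source with irredundant core $A=\mathrm{Atom}(S_O)$ and reconstruction alphabet $\hat S_O$. Assume $S_O\subseteq\hat S_O$; that for every integer $\delta\ge 0$ and all distinct $a_1,a_2\in A_\delta$ one has $R_\delta(a_1)\cap R_\delta(a_2)=\varnothing$; and that $A=\{s\in S_O: s\notin\mathrm{Cn}(S_O\setminus\{s\})\}$. Then: (i) $R_{\mathrm{sem}}(0,0;d_{\mathrm{Cn}}^{0},P_O)=H(P_O)$; (ii) $R_{\mathrm{sem}}(0,\delta;d_{\mathrm{Cn}}^{\delta},P_O)=P_AH(\pi_A)$ for all integers $\delta\ge\mathsf{D_d}$ (the right-hand side being read as $0$ when $P_A=0$); (iii) the function $\delta\mapsto R_{\mathrm{sem}}(0,\delta;d_{\mathrm{Cn}}^{\delta},P_O)$ on the nonnegative integers is non-increasing.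
   Context: Setting. $\mathbb{S}_O$ is a finite set of statements with a fixed proof system with decidable derivability; $\mathrm{Cn}(\Gamma)\subseteq\mathbb{S}_O$ is the set of statements derivable from $\Gamma\subseteq\mathbb{S}_O$; $\mathrm{Cn}$ is reflexive, monotone and idempotent. $S_O\subseteq\mathbb{S}_O$ is a finite knowledge base with a fixed linear (canonical) order, $\hat S_O\subseteq\mathbb{S}_O$ a nonempty finite reconstruction alphabet, and a deductive source is a pair $(S_O,P_O)$ with $P_O$ a probability distribution on $S_O$. Core. $\mathrm{Atom}(S_O)$ is the output of the deletion procedure: start with $B=S_O$; scan the elements $s$ of $S_O$ in the canonical order; whenever the scanned $s$ satisfies $s\in\mathrm{Cn}(B\setminus\{s\})$ for the current $B$, remove $s$ from $B$; the final $B$ is $\mathrm{Atom}(S_O)$. Put $A=\mathrm{Atom}(S_O)$, $P_A=P_O(A)$ and, if $P_A>0$, $\pi_A(a)=P_O(a)/P_A$ for $a\in A$. Finite-step closure. There is a computable operator $T=T_{\mathsf{PS}}$ on finite subsets of $\mathbb{S}_O$ with: $T(B)\supseteq B$; $B\subseteq B'\Rightarrow T(B)\subseteq T(B')$; with $T^0(B)=B$, $T^{n+1}(B)=T(T^n(B))$ one has $\mathrm{Cn}(B)=\bigcup_{n\ge0}T^n(B)$; and the sequence $T^n(B)$ stabilizes after finitely many iterations. The derivation depth is $\mathrm{Dd}(s\mid B)=\min\{n\ge0: s\in T^n(B)\}$ ($\infty$ if $s\notin\mathrm{Cn}(B)$), and $\mathsf{D_d}=\max_{q\in S_O}\mathrm{Dd}(q\mid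 A)$ (with $\max\varnothing=0$). $\delta$-step closure distortion. For an integer $\delta\ge0$, $s\in S_O$, $\hat s\in\hat S_O$: $d_{\mathrm{Cn}}^{\delta}(s,\hat s)=d_{\mathrm{Cn}}^{\delta}(s,\hat s\mid S_O)=0$ if $S_O\subseteq T^\delta((S_O\setminus\{s\})\cup\{\hat s\})$, and $=1$ otherwise. $A_\delta=\{s\in S_O: s\notin T^\delta(S_O\setminus\{s\})\}$, and for $a\in A_\delta$, $R_\delta(a)=\{\hat s\in\hat S_O: d_{\mathrm{Cn}}^{\delta}(a,\hat s\mid S_O)=0\}$. Rate–depth–distortion function. $R_{\mathrm{sem}}(D,\delta;d_{\mathrm{Cn}}^{\delta},P_O)$ is the minimum of the mutual information $I(\mathsf S_o;\hat{\mathsf S}_o)$ over test channels $P_{\hat S\mid S}$ from $S_O$ to $\hat S_O$ with $\mathbb{E}[d_{\mathrm{Cn}}^{\delta}(\mathsf S_o,\hat{\mathsf S}_o)]\le D$, where $\mathsf S_o\sim P_O$ ($+\infty$ if no such channel exists). $H$ is Shannon entropy. *)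

theory Defs
  imports "HOL-Probability.Probability"
begin

(* The finite set of all statements is the type 's :: finite, so every set of statements is
   finite and every operator on such sets is computable. *)

locale proof_system =
  fixes Cn :: "'s::finite set \<Rightarrow> 's set"
    and T :: "'s set \<Rightarrow> 's set"
  assumes Cn_reflexive: "\<Gamma> \<subseteq> Cn \<Gamma>"
    and Cn_mono: "\<Gamma> \<subseteq> \<Gamma>' \<Longrightarrow> Cn \<Gamma> \<subseteq> Cn \<Gamma>'"
    and Cn_idem: "Cn (Cn \<Gamma>) = Cn \<Gamma>"
    and T_extensive: "B \<subseteq> T B"
    and T_mono: "B \<subseteq> B' \<Longrightarrow> T B \<subseteq> T B'"
    and Cn_eq_Union: "Cn B = (\<Union>n. (T ^^ n) B)"
    and T_stabilizes: "\<exists>N. \<forall>n\<ge>N. (T ^^ n) B = (T ^^ N) B"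

(* A knowledge base with its canonical linear order is a distinct list. The set threaded
   through the fold is the current B. *)
definition Atom :: "('s set \<Rightarrow> 's set) \<Rightarrow> 's list \<Rightarrow> 's set" where
  "Atom Cn xs = fold (\<lambda>s B. if s \<in> Cn (B - {s}) then B - {s} else B) xs (set xs)"

definition Dd :: "('s set \<Rightarrow> 's set) \<Rightarrow> 's \<Rightarrow> 's set \<Rightarrow> enat" where
  "Dd T s B = (if \<exists>n. s \<in> (T ^^ n) B then enat (LEAST n. s \<in> (T ^^ n) B) else \<infinity>)"

definition max_depth :: "('s set \<Rightarrow> 's set) \<Rightarrow> 's set \<Rightarrow> 's set \<Rightarrow> enat" where
  "max_depth T S A = (if S = {} then 0 else Max ((\<lambda>q. Dd T q A) ` S))"

definition d_Cn :: "('s set \<Rightarrow> 's set) \<Rightarrow> 's set \<Rightarrow> nat \<Rightarrow> 's \<Rightarrow> 's \<Rightarrow> real" where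
  "d_Cn T S \<delta> s s' = (if S \<subseteq> (T ^^ \<delta>) ((S - {s}) \<union> {s'}) then 0 else 1)"

definition A_depth :: "('s set \<Rightarrow> 's set) \<Rightarrow> 's set \<Rightarrow> nat \<Rightarrow> 's set" where
  "A_depth T S \<delta> = {s \<in> S. s \<notin> (T ^^ \<delta>) (S - {s})}"

definition R_depth :: "('s set \<Rightarrow> 's set) \<Rightarrow> 's set \<Rightarrow> 's set \<Rightarrow> nat \<Rightarrow> 's \<Rightarrow> 's set" where
  "R_depth T S S' \<delta> a = {s' \<in> S'. d_Cn T S \<delta> a s' = 0}"

definition shannon_entropy :: "real \<Rightarrow> 's::finite pmf \<Rightarrow> real" where
  "shannon_entropy b P = prob_space.entropy (measure_pmf P) b (count_space UNIV) (\<lambda>x. x)"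

definition joint_pmf :: "'s pmf \<Rightarrow> ('s \<Rightarrow> 't pmf) \<Rightarrow> ('s \<times> 't) pmf" where
  "joint_pmf P W = bind_pmf P (\<lambda>s. map_pmf (Pair s) (W s))"

definition channel_information :: "real \<Rightarrow> 's::finite pmf \<Rightarrow> ('s \<Rightarrow> 't::finite pmf) \<Rightarrow> real" where
  "channel_information b P W =
     prob_space.mutual_information (measure_pmf (joint_pmf P W)) b
       (count_space UNIV) (count_space UNIV) fst snd"

(* Values W s with s outside S are irrelevant: sources P are supported in S. *)
definition test_channels ::
  "'s set \<Rightarrow> 't set \<Rightarrow> ('s \<Rightarrow> 't \<Rightarrow> real) \<Rightarrow> 's pmf \<Rightarrow> real \<Rightarrow> ('s \<Rightarrow> 't pmf) set" where
  "test_channels S S' d P D =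
     {W. (\<forall>s\<in>S. set_pmf (W s) \<subseteq> S') \<and>
         measure_pmf.expectation (joint_pmf P W) (\<lambda>(s, s'). d s s') \<le> D}"

(* On reals, LEAST denotes an attained minimum. It exists here whenever a channel exists:
   mutual information is continuous on the compact set of admissible channel matrices. *)
definition rate_distortion ::
  "real \<Rightarrow> 's::finite set \<Rightarrow> 't::finite set \<Rightarrow> ('s \<Rightarrow> 't \<Rightarrow> real) \<Rightarrow> 's pmf \<Rightarrow> real \<Rightarrow> ereal" where
  "rate_distortion b S S' d P D =
     (if test_channels S S' d P D = {} then \<infinity>
      else ereal (LEAST r. r \<in> channel_information b P ` test_channels S S' d P D))"

definition R_sem ::
  "real \<Rightarrow> ('s::finite set \<Rightarrow> 's set) \<Rightarrow> 's set \<Rightarrow> 's set \<Rightarrow> 's pmf \<Rightarrow> real \<Rightarrow> nat \<Rightarrow> ereal" where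
  "R_sem b T S S' P D \<delta> = rate_distortion b S S' (d_Cn T S \<delta>) P D"

end

theory Submission
  imports Defs
begin

text \<open>At zero distortion a redundant statement may be reconstructed arbitrarily, whereas distinct
  core elements must have disjoint output supports. For the converse, applying \<open>ln x \<le> x - 1\<close> to
  the ratio of \<open>q t * g s\<close> and \<open>W s t\<close>, where \<open>q\<close> is the output law, \<open>g s = P A / P s\<close> on the core
  and \<open>g s = 1\<close> off it, bounds the information below by the core entropy in a single step.
  Equality holds if core elements are copied and every redundant statement is sent to an
  independent sample of the source conditioned on the core: the output law is then this
  conditional law, so redundant statements carry no information.\<close>

section \<open>Entropy and mutual information as finite sums\<close>

lemma information_space_measure_pmf: "b > 1 \<Longrightarrow> information_space (measure_pmf p) b"
  by (simp add: information_space_def information_space_axioms_def measure_pmf.prob_space_axioms)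

lemma distributed_pmf:
  "distributed (measure_pmf p) (count_space UNIV) f (\<lambda>x. ennreal (pmf (map_pmf f p) x))"
  by (simp add: distributed_def map_pmf_rep_eq[symmetric] measure_pmf_eq_density[symmetric])

lemma shannon_entropy_eq_sum:
  fixes P :: "'s::finite pmf"
  assumes "b > 1"
  shows "shannon_entropy b P = - (\<Sum>x\<in>UNIV. pmf P x * log b (pmf P x))"
proof -
  interpret information_space "measure_pmf P" b
    using assms by (rule information_space_measure_pmf)
  have "distributed (measure_pmf P) (count_space UNIV) (\<lambda>x. x) (\<lambda>x. ennreal (pmf P x))"
    using distributed_pmf[of P "\<lambda>x. x"] by (simp add: map_pmf_ident)
  from entropy_distr[OF this] show ?thesis
    unfolding shannon_entropy_def by (simp add: lebesgue_integral_count_space_finite)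
qed

lemma pmf_joint_pmf: "pmf (joint_pmf P W) (s, t) = pmf P s * pmf (W s) t" for P :: "'s::finite pmf"
proof -
  have "pmf (map_pmf (Pair s') (W s')) (s, t) = (if s' = s then pmf (W s) t else 0)" for s'
    by (auto simp: pmf_map_inj' inj_on_def intro!: pmf_map_outside)
  then show ?thesis
    unfolding joint_pmf_def pmf_bind
    by (subst integral_measure_pmf_real[where A="{s}"]) (auto split: if_splits)
qed

lemma map_fst_joint_pmf: "map_pmf fst (joint_pmf P W) = P"
  by (simp add: joint_pmf_def map_bind_pmf map_pmf_comp bind_return_pmf')

lemma map_snd_joint_pmf: "map_pmf snd (joint_pmf P W) = bind_pmf P W"
  by (simp add: joint_pmf_def map_bind_pmf map_pmf_comp map_pmf_ident)

lemma pmf_bind_finite: "pmf (bind_pmf P W) t = (\<Sum>s\<in>UNIV. pmf P s * pmf (W s) t)"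
  for P :: "'s::finite pmf"
  unfolding pmf_bind by (subst integral_measure_pmf_real[where A=UNIV]) (auto simp: mult.commute)

lemma channel_information_eq_sum:
  fixes P :: "'s::finite pmf" and W :: "'s \<Rightarrow> 't::finite pmf"
  assumes "b > 1"
  shows "channel_information b P W =
    (\<Sum>s\<in>UNIV. \<Sum>t\<in>UNIV. pmf P s * pmf (W s) t * log b (pmf (W s) t / pmf (bind_pmf P W) t))"
proof -
  let ?J = "joint_pmf P W"
  interpret information_space "measure_pmf ?J" b
    using assms by (rule information_space_measure_pmf)
  have UU: "count_space UNIV \<Otimes>\<^sub>M count_space UNIV = count_space (UNIV :: ('s \<times> 't) set)"
    by (simp add: pair_measure_countable)
  have sf: "sigma_finite_measure (count_space (UNIV :: 'x::finite set))"
    by (simp add: sigma_finite_measure_count_space_finite)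
  have 1: "distributed (measure_pmf ?J) (count_space UNIV) fst (\<lambda>x. ennreal (pmf P x))"
    using distributed_pmf[of ?J fst] by (simp add: map_fst_joint_pmf)
  have 2: "distributed (measure_pmf ?J) (count_space UNIV) snd (\<lambda>x. ennreal (pmf (bind_pmf P W) x))"
    using distributed_pmf[of ?J snd] by (simp add: map_snd_joint_pmf)
  have 3: "distributed (measure_pmf ?J) (count_space UNIV \<Otimes>\<^sub>M count_space UNIV)
      (\<lambda>x. (fst x, snd x)) (\<lambda>x. ennreal (pmf ?J x))"
    unfolding UU using distributed_pmf[of ?J "\<lambda>x. x"] by (simp add: map_pmf_ident)
  have "channel_information b P W = (\<Sum>x\<in>UNIV. pmf ?J x *
      log b (pmf ?J x / (pmf P (fst x) * pmf (bind_pmf P W) (snd x))))"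
    unfolding channel_information_def
    by (subst mutual_information_distr[OF sf sf 1 _ 2 _ 3])
      (simp_all add: UU lebesgue_integral_count_space_finite)
  also have "\<dots> = (\<Sum>(s, t)\<in>UNIV \<times> UNIV.
      pmf P s * pmf (W s) t * log b (pmf (W s) t / pmf (bind_pmf P W) t))"
    \<comment> \<open>The source weight cancels inside the logarithm; where it is zero, the leading
      factor makes both summands vanish.\<close>
    by (intro sum.cong) (auto simp: pmf_joint_pmf)
  finally show ?thesis
    by (simp add: sum.cartesian_product)
qed

section \<open>The entropy contributed by a core\<close>

definition core_entropy :: "real \<Rightarrow> 's pmf \<Rightarrow> 's set \<Rightarrow> real" where
  "core_entropy b P A = (\<Sum>s\<in>A. pmf P s * log b (measure_pmf.prob P A / pmf P s))"

lemma core_entropy_eq: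
  fixes P :: "'s::finite pmf"
  assumes b: "b > 1"
  shows "core_entropy b P A = (if measure_pmf.prob P A = 0 then 0
    else measure_pmf.prob P A * shannon_entropy b (cond_pmf P A))"
proof (cases "measure_pmf.prob P A = 0")
  case True
  then have "pmf P s = 0" if "s \<in> A" for s
    using that by (simp add: measure_measure_pmf_finite sum_nonneg_eq_0_iff)
  with True show ?thesis by (simp add: core_entropy_def)
next
  case False
  let ?p = "measure_pmf.prob P A"
  have p: "?p > 0" using False by (simp add: zero_less_measure_iff)
  have ne: "set_pmf P \<inter> A \<noteq> {}"
    using False by (auto simp: measure_pmf_zero_iff)
  have "?p * shannon_entropy b (cond_pmf P A) =
      (\<Sum>x\<in>UNIV. if x \<in> A then pmf P x * - log b (pmf P x / ?p) else 0)"
    unfolding shannon_entropy_eq_sum[OF b] sum_negf[symmetric] sum_distrib_left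
    using p by (intro sum.cong) (auto simp: pmf_cond[OF ne])
  also have "\<dots> = (\<Sum>x\<in>A. pmf P x * - log b (pmf P x / ?p))"
    by (simp add: sum.If_cases)
  also have "\<dots> = core_entropy b P A"
    unfolding core_entropy_def
  proof (intro sum.cong refl)
    fix x
    show "pmf P x * - log b (pmf P x / ?p) = pmf P x * log b (?p / pmf P x)"
    proof (cases "pmf P x = 0")
      case False
      then have "pmf P x > 0" by (simp add: pmf_positive_iff set_pmf_iff)
      then show ?thesis using p b by (simp add: log_divide_pos)
    qed simp
  qed
  finally show ?thesis using False by simp
qed

lemma core_entropy_full:
  fixes P :: "'s::finite pmf"
  assumes "b > 1" and S: "set_pmf P \<subseteq> S"
  shows "core_entropy b P S = shannon_entropy b P"
proof -
  have 1: "measure_pmf.prob P S = 1"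
    using S by (simp add: measure_pmf.prob_eq_1 AE_measure_pmf_iff subset_iff)
  have ne: "set_pmf P \<inter> S \<noteq> {}"
    using S set_pmf_not_empty[of P] by blast
  have "cond_pmf P S = P"
    using S 1 by (intro pmf_eqI) (auto simp: pmf_cond[OF ne] set_pmf_iff)
  then show ?thesis
    using assms(1) 1 by (simp add: core_entropy_eq)
qed

text \<open>Enlarging the set raises the mass in the numerator of every old logarithm, and each new
  summand is nonnegative because a point weighs at most as much as a set containing it.\<close>

lemma core_entropy_mono:
  fixes P :: "'s::finite pmf"
  assumes "b > 1" and "A \<subseteq> B"
  shows "core_entropy b P A \<le> core_entropy b P B"
  unfolding core_entropy_def
proof (rule order.trans[OF sum_mono sum_mono2])
  show "pmf P s * log b (measure_pmf.prob P A / pmf P s)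
      \<le> pmf P s * log b (measure_pmf.prob P B / pmf P s)" if "s \<in> A" for s
  proof (cases "pmf P s = 0")
    case False
    then have P: "pmf P s > 0" by (simp add: pmf_positive_iff set_pmf_iff)
    have "pmf P s \<le> measure_pmf.prob P A"
      using that by (simp add: pmf.rep_eq measure_pmf.finite_measure_mono)
    moreover have "measure_pmf.prob P A \<le> measure_pmf.prob P B"
      using assms(2) by (simp add: measure_pmf.finite_measure_mono)
    ultimately show ?thesis
      using P assms(1) by (intro mult_left_mono) (auto simp: divide_right_mono)
  qed simp
  show "0 \<le> pmf P s * log b (measure_pmf.prob P B / pmf P s)" if "s \<in> B - A" for s
  proof (cases "pmf P s = 0")
    case False
    then have "pmf P s > 0" by (simp add: pmf_positive_iff set_pmf_iff)
    moreover have "pmf P s \<le> measure_pmf.prob P B"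
      using that by (simp add: pmf.rep_eq measure_pmf.finite_measure_mono)
    ultimately show ?thesis using assms(1) by simp
  qed simp
qed (use assms in auto)

section \<open>Lower bound on the information and a channel attaining it\<close>

text \<open>Disjointness lets each output letter come from at most one core element of positive
  probability. Hence the measure \<open>r\<close>, with which the joint law is compared, has total
  mass at most 1.\<close>

lemma core_entropy_le_channel_information:
  fixes P :: "'s::finite pmf" and W :: "'s \<Rightarrow> 't::finite pmf"
  assumes b: "b > 1"
    and disj: "\<And>s s'. \<lbrakk>s \<in> A \<inter> set_pmf P; s' \<in> A \<inter> set_pmf P; s \<noteq> s'\<rbrakk>
      \<Longrightarrow> set_pmf (W s) \<inter> set_pmf (W s') = {}"
  shows "core_entropy b P A \<le> channel_information b P W"
proof -
  define p where "p = measure_pmf.prob P A"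
  define q where "q = pmf (bind_pmf P W)"
  \<comment> \<open>This is \<open>q t * g s * pmf P s\<close> cut down to the support of the joint
    law; without the cut every core element would contribute \<open>q t * p\<close> to column
    \<open>t\<close>.\<close>
  define r where "r s t = (if pmf P s = 0 \<or> pmf (W s) t = 0 then 0
    else q t * (if s \<in> A then p else pmf P s))" for s t
  \<comment> \<open>The logarithm of \<open>g s\<close>, whose mean under \<open>P\<close> is the
    core entropy.\<close>
  define c where "c s = (if s \<in> A then log b (p / pmf P s) else 0)" for s
  have sum1: "(\<Sum>x\<in>UNIV. pmf Q x) = 1" for Q :: "'x::finite pmf"
    by (rule sum_pmf_eq_1) auto
  have p_sum: "p = (\<Sum>s\<in>A. pmf P s)"
    by (simp add: p_def measure_measure_pmf_finite)
  have q_nonneg: "q t \<ge> 0" for t by (simp add: q_def)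
  have p_nonneg: "p \<ge> 0" by (simp add: p_def)
  have split: "(\<Sum>s\<in>UNIV. f s) = (\<Sum>s\<in>A. f s) + (\<Sum>s\<in>-A. f s)" for f :: "'s \<Rightarrow> real"
    using sum.subset_diff[of A UNIV f] by (simp add: Compl_eq_Diff_UNIV add.commute)
  \<comment> \<open>The inequality for \<open>ln\<close>, weighted by the joint law; the factor
    \<open>ln b\<close> converts \<open>log b\<close> to \<open>ln\<close>. Off the support both
    sides are 0.\<close>
  have pointwise: "pmf P s * pmf (W s) t - r s t
      \<le> ln b * (pmf P s * pmf (W s) t * (log b (pmf (W s) t / q t) - c s))" for s t
  proof (cases "pmf P s = 0 \<or> pmf (W s) t = 0")
    case False
    then have P: "pmf P s > 0" and W: "pmf (W s) t > 0"
      by (auto simp: pmf_positive_iff set_pmf_iff)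
    have "pmf P s * pmf (W s) t \<le> q t"
      unfolding q_def pmf_bind_finite by (rule member_le_sum) auto
    with P W have q: "q t > 0"
      by (meson mult_pos_pos less_le_trans)
    have pA: "p > 0" if "s \<in> A"
      using P that member_le_sum[of s A "pmf P"] by (simp add: p_sum)
    define g where "g = (if s \<in> A then p / pmf P s else 1)"
    have g: "g > 0" using P pA by (simp add: g_def)
    have lng: "ln b * (log b (pmf (W s) t / q t) - c s) = - ln (q t * g / pmf (W s) t)"
    proof -
      have "ln b * c s = ln g" using b by (simp add: c_def g_def log_def)
      moreover have "ln b * log b (pmf (W s) t / q t) = ln (pmf (W s) t / q t)"
        using b by (simp add: log_def)
      ultimately show ?thesis
        using W q g by (simp add: right_diff_distrib ln_div ln_mult)
    qed
    have "ln (q t * g / pmf (W s) t) \<le> q t * g / pmf (W s) t - 1"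
      using P W q g by (intro ln_le_minus_one) simp
    then have "pmf P s * pmf (W s) t * (1 - q t * g / pmf (W s) t)
        \<le> pmf P s * pmf (W s) t * (ln b * (log b (pmf (W s) t / q t) - c s))"
      unfolding lng by (intro mult_left_mono) auto
    moreover have "pmf P s * pmf (W s) t * (1 - q t * g / pmf (W s) t)
        = pmf P s * pmf (W s) t - r s t"
      using P W by (auto simp: r_def g_def field_simps)
    ultimately show ?thesis by (simp add: algebra_simps)
  qed (auto simp: r_def)
  \<comment> \<open>In column \<open>t\<close> the core has at most one nonzero entry,
    \<open>q t * p\<close>, and the other rows add at most \<open>q t * (1 - p)\<close>.\<close>
  have r_bound: "(\<Sum>s\<in>UNIV. r s t) \<le> q t" for t
  proof -
    have "(\<Sum>s\<in>A. r s t) \<le> q t * p"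
    proof (cases "\<exists>a\<in>A. pmf P a \<noteq> 0 \<and> pmf (W a) t \<noteq> 0")
      case True
      then obtain a where a: "a \<in> A" "pmf P a \<noteq> 0" "pmf (W a) t \<noteq> 0" by blast
      have "r s t = 0" if "s \<in> A - {a}" for s
        using disj[of s a] a that by (auto simp: r_def set_pmf_iff disjoint_iff)
      then have "(\<Sum>s\<in>A. r s t) = r a t"
        using a(1) by (simp add: sum.remove[of A a])
      then show ?thesis using a by (simp add: r_def)
    next
      case False
      then have "(\<Sum>s\<in>A. r s t) = 0" by (intro sum.neutral) (auto simp: r_def)
      then show ?thesis using q_nonneg p_nonneg by simp
    qed
    moreover have "(\<Sum>s\<in>-A. r s t) \<le> (\<Sum>s\<in>-A. q t * pmf P s)"
      using q_nonneg by (intro sum_mono) (auto simp: r_def)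
    moreover have "p + (\<Sum>s\<in>-A. pmf P s) = 1"
      using split[of "pmf P"] by (simp add: sum1 p_sum)
    ultimately show ?thesis
      unfolding split sum_distrib_left[symmetric] by (metis add_mono distrib_left mult.right_neutral)
  qed
  have PW: "(\<Sum>s\<in>UNIV. \<Sum>t\<in>UNIV. pmf P s * pmf (W s) t) = 1"
    by (simp add: sum_distrib_left[symmetric] sum1)
  \<comment> \<open>Summing by columns bounds the mass of \<open>r\<close> by that of
    \<open>q\<close>, which is 1, the mass of the joint law.\<close>
  have "(\<Sum>s\<in>UNIV. \<Sum>t\<in>UNIV. r s t) = (\<Sum>t\<in>UNIV. \<Sum>s\<in>UNIV. r s t)"
    by (rule sum.swap)
  also have "\<dots> \<le> (\<Sum>t\<in>UNIV. q t)" by (intro sum_mono r_bound)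
  finally have "0 \<le> (\<Sum>s\<in>UNIV. \<Sum>t\<in>UNIV. pmf P s * pmf (W s) t - r s t)"
    by (simp add: sum_subtractf PW q_def sum1)
  also have "\<dots> \<le> (\<Sum>s\<in>UNIV. \<Sum>t\<in>UNIV.
      ln b * (pmf P s * pmf (W s) t * (log b (pmf (W s) t / q t) - c s)))"
    by (intro sum_mono pointwise)
  also have "\<dots> = ln b * (channel_information b P W
      - (\<Sum>s\<in>UNIV. \<Sum>t\<in>UNIV. pmf P s * pmf (W s) t * c s))"
    unfolding channel_information_eq_sum[OF b] q_def
      sum_subtractf[symmetric] right_diff_distrib[symmetric] sum_distrib_left ..
  also have "(\<Sum>s\<in>UNIV. \<Sum>t\<in>UNIV. pmf P s * pmf (W s) t * c s) = (\<Sum>s\<in>UNIV. pmf P s * c s)"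
    unfolding sum_distrib_right[symmetric] sum_distrib_left[symmetric] sum1 by simp
  also have "\<dots> = core_entropy b P A"
    by (simp add: split core_entropy_def c_def p_def)
  finally show ?thesis
    using b by (simp add: zero_le_mult_iff)
qed

text \<open>The hypothesis on \<open>Q\<close> is the conditional law on \<open>A\<close> with its
  denominator cleared, so that any \<open>Q\<close> satisfies it when \<open>A\<close> has mass
  zero.\<close>

lemma channel_information_copy_core:
  fixes P :: "'s::finite pmf"
  assumes b: "b > 1"
    and Q: "\<And>x. measure_pmf.prob P A * pmf Q x = (if x \<in> A then pmf P x else 0)"
  shows "channel_information b P (\<lambda>s. if s \<in> A then return_pmf s else Q) = core_entropy b P A"
    (is "channel_information b P ?W = _")
proof -
  let ?p = "measure_pmf.prob P A"
  have compl: "(\<Sum>s\<in>-A. pmf P s) = 1 - ?p"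
    using measure_pmf.prob_compl[of A P] by (simp add: Compl_eq_Diff_UNIV measure_measure_pmf_finite)
  \<comment> \<open>Copying the core contributes \<open>?p * pmf Q t\<close> and the redundant rows
    contribute \<open>(1 - ?p) * pmf Q t\<close>.\<close>
  have bind: "bind_pmf P ?W = Q"
  proof (rule pmf_eqI)
    fix t
    have "pmf (bind_pmf P ?W) t =
        (\<Sum>s\<in>UNIV. if s \<in> A then pmf P s * indicator {t} s else pmf P s * pmf Q t)"
      unfolding pmf_bind_finite by (intro sum.cong) (auto simp: indicator_def)
    also have "\<dots> = (\<Sum>s\<in>A. pmf P s * indicator {t} s) + (\<Sum>s\<in>-A. pmf P s * pmf Q t)"
      by (simp add: sum.If_cases)
    also have "(\<Sum>s\<in>A. pmf P s * indicator {t} s) = ?p * pmf Q t"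
      by (simp add: Q indicator_def)
    also have "(\<Sum>s\<in>-A. pmf P s * pmf Q t) = (1 - ?p) * pmf Q t"
      by (simp add: sum_distrib_right[symmetric] compl)
    finally show "pmf (bind_pmf P ?W) t = pmf Q t"
      by (simp add: algebra_simps)
  qed
  \<comment> \<open>A core row keeps only its diagonal term; a redundant row compares
    \<open>Q\<close> with itself.\<close>
  have row: "(\<Sum>t\<in>UNIV. pmf P s * pmf (?W s) t * log b (pmf (?W s) t / pmf Q t))
      = (if s \<in> A then pmf P s * log b (?p / pmf P s) else 0)" for s
  proof (cases "s \<in> A")
    case True
    have "(\<Sum>t\<in>UNIV. pmf P s * pmf (?W s) t * log b (pmf (?W s) t / pmf Q t))
        = (\<Sum>t\<in>UNIV. if t = s then pmf P s * log b (1 / pmf Q s) else 0)"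
      using True by (intro sum.cong) (auto simp: indicator_def)
    also have "\<dots> = pmf P s * log b (1 / pmf Q s)" by simp
    also have "\<dots> = pmf P s * log b (?p / pmf P s)"
    proof (cases "pmf P s = 0")
      case nz: False
      have "?p * pmf Q s = pmf P s" using Q[of s] True by simp
      with nz have "1 / pmf Q s = ?p / pmf P s"
        by (auto simp: divide_eq_eq eq_divide_eq mult.commute)
      then show ?thesis by simp
    qed simp
    finally show ?thesis using True by simp
  next
    case False
    \<comment> \<open>The quotient is 1 unless \<open>pmf Q t\<close> is zero, and then the leading
      factor is zero as well.\<close>
    have "pmf P s * pmf Q t * log b (pmf Q t / pmf Q t) = 0" for t
      by (cases "pmf Q t = 0") auto
    with False show ?thesis
      by (simp only: if_False sum.neutral_const)
  qed
  show ?thesis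
    unfolding channel_information_eq_sum[OF b] bind row
    by (simp add: core_entropy_def sum.If_cases)
qed

section \<open>The rate-distortion function at zero distortion\<close>

text \<open>A nonnegative variable with mean at most zero vanishes almost surely, which turns the
  averaged constraint into one on supports.\<close>

lemma test_channels_zero_distortion:
  fixes P :: "'s::finite pmf" and S' :: "'t::finite set"
  assumes "\<And>s t. d s t \<ge> 0"
  shows "test_channels S S' d P 0 = {W. (\<forall>s\<in>S. set_pmf (W s) \<subseteq> S') \<and>
    (\<forall>s\<in>set_pmf P. \<forall>t\<in>set_pmf (W s). d s t = 0)}"
proof -
  have "measure_pmf.expectation (joint_pmf P W) (\<lambda>(s, t). d s t) \<le> 0 \<longleftrightarrow>
      (\<forall>s\<in>set_pmf P. \<forall>t\<in>set_pmf (W s). d s t = 0)" for W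
  proof -
    have "measure_pmf.expectation (joint_pmf P W) (\<lambda>(s, t). d s t) \<ge> 0"
      using assms by (intro Bochner_Integration.integral_nonneg) auto
    then have "measure_pmf.expectation (joint_pmf P W) (\<lambda>(s, t). d s t) \<le> 0 \<longleftrightarrow>
        measure_pmf.expectation (joint_pmf P W) (\<lambda>(s, t). d s t) = 0"
      by linarith
    also have "\<dots> \<longleftrightarrow> (AE x in measure_pmf (joint_pmf P W). (case x of (s, t) \<Rightarrow> d s t) = 0)"
      using assms by (intro integral_nonneg_eq_0_iff_AE integrable_measure_pmf_finite) auto
    also have "\<dots> \<longleftrightarrow> (\<forall>s\<in>set_pmf P. \<forall>t\<in>set_pmf (W s). d s t = 0)"
      by (auto simp: AE_measure_pmf_iff joint_pmf_def)
    finally show ?thesis .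
  qed
  then show ?thesis by (auto simp: test_channels_def)
qed

lemma rate_distortion_eqI:
  assumes "W \<in> test_channels S S' d P D" and "channel_information b P W = v"
    and "\<And>W'. W' \<in> test_channels S S' d P D \<Longrightarrow> v \<le> channel_information b P W'"
  shows "rate_distortion b S S' d P D = ereal v"
proof -
  have "(LEAST r. r \<in> channel_information b P ` test_channels S S' d P D) = v"
    using assms by (intro Least_equality) auto
  with assms(1) show ?thesis by (auto simp: rate_distortion_def)
qed

text \<open>Isolates the properties of the distortion that fix the value: the lower bound uses only
  \<open>d_disjoint\<close>, while \<open>d_self\<close> and \<open>d_redundant\<close> make the
  copying channel admissible.\<close>

lemma rate_distortion_zero_eq_core_entropy:
  fixes P :: "'s::finite pmf"
  assumes b: "b > 1" and S: "set_pmf P \<subseteq> S" "S \<subseteq> S'" "A \<subseteq> S"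
    and d_nonneg: "\<And>s t. d s t \<ge> 0"
    and d_self: "\<And>s. s \<in> A \<Longrightarrow> d s s = 0"
    and d_redundant: "\<And>s t. s \<in> S - A \<Longrightarrow> d s t = 0"
    and d_disjoint: "\<And>s s' t. \<lbrakk>s \<in> A; s' \<in> A; t \<in> S'; d s t = 0; d s' t = 0\<rbrakk> \<Longrightarrow> s = s'"
  shows "rate_distortion b S S' d P 0 = ereal (core_entropy b P A)"
proof -
  obtain Q where Q: "\<And>x. measure_pmf.prob P A * pmf Q x = (if x \<in> A then pmf P x else 0)"
    and QS: "set_pmf Q \<subseteq> S"
  \<comment> \<open>If the core has no mass, \<open>P\<close> itself serves as \<open>Q\<close>; it
    keeps the outputs inside \<open>S\<close>, hence inside \<open>S'\<close>.\<close>
  proof (cases "set_pmf P \<inter> A = {}")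
    case True
    then have "measure_pmf.prob P A = 0" "\<forall>x\<in>A. pmf P x = 0"
      by (auto simp: measure_pmf_zero_iff set_pmf_iff)
    then show ?thesis using S(1) by (intro that[of P]) auto
  next
    case False
    then have "measure_pmf.prob P A \<noteq> 0" by (simp add: measure_pmf_zero_iff)
    then show ?thesis
      using S(1) False by (intro that[of "cond_pmf P A"]) (auto simp: pmf_cond[OF False])
  qed
  let ?W = "\<lambda>s. if s \<in> A then return_pmf s else Q"
  show ?thesis
  proof (rule rate_distortion_eqI[where W = ?W])
    show "?W \<in> test_channels S S' d P 0"
      unfolding test_channels_zero_distortion[OF d_nonneg]
      using S QS d_self d_redundant by auto
    show "channel_information b P ?W = core_entropy b P A"
      by (rule channel_information_copy_core[OF b Q])
    fix W assume "W \<in> test_channels S S' d P 0"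
    then have W: "\<And>s t. s \<in> S \<Longrightarrow> t \<in> set_pmf (W s) \<Longrightarrow> t \<in> S'"
        "\<And>s t. s \<in> set_pmf P \<Longrightarrow> t \<in> set_pmf (W s) \<Longrightarrow> d s t = 0"
      unfolding test_channels_zero_distortion[OF d_nonneg] by auto
    show "core_entropy b P A \<le> channel_information b P W"
    proof (rule core_entropy_le_channel_information[OF b])
      fix s s' assume s: "s \<in> A \<inter> set_pmf P" "s' \<in> A \<inter> set_pmf P" "s \<noteq> s'"
      \<comment> \<open>A common output letter would have distortion zero to two distinct core
        elements.\<close>
      have False if "t \<in> set_pmf (W s)" "t \<in> set_pmf (W s')" for t
        using d_disjoint[of s s' t] W(1)[of s t] W(2)[of s t] W(2)[of s' t] s that S(3) by blast
      then show "set_pmf (W s) \<inter> set_pmf (W s') = {}" by blast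
    qed
  qed
qed

section \<open>Finite-step closure and the depth-dependent core\<close>

context proof_system
begin

lemma funpow_T_mono: "B \<subseteq> B' \<Longrightarrow> (T ^^ n) B \<subseteq> (T ^^ n) B'"
  by (induction n) (auto dest: T_mono)

lemma funpow_T_increasing: "m \<le> n \<Longrightarrow> (T ^^ m) B \<subseteq> (T ^^ n) B"
  by (rule lift_Suc_mono_le) (use T_extensive in auto)

lemma funpow_T_extensive: "B \<subseteq> (T ^^ n) B"
  using funpow_T_increasing[of 0 n] by simp

lemma d_Cn_self: "s \<in> S \<Longrightarrow> d_Cn T S n s s = 0"
  using funpow_T_extensive by (simp add: d_Cn_def insert_absorb)

text \<open>The remaining statements already yield \<open>s\<close> within \<open>n\<close> steps,
  and adding \<open>t\<close> to them loses nothing by monotonicity.\<close>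

lemma d_Cn_redundant:
  assumes "s \<in> S - A_depth T S n"
  shows "d_Cn T S n s t = 0"
proof -
  have "S - {s} \<subseteq> (T ^^ n) ((S - {s}) \<union> {t})"
    using funpow_T_extensive[of "(S - {s}) \<union> {t}" n] by blast
  moreover have "s \<in> (T ^^ n) ((S - {s}) \<union> {t})"
    using assms funpow_T_mono[of "S - {s}" "(S - {s}) \<union> {t}" n] by (auto simp: A_depth_def)
  ultimately show ?thesis by (auto simp: d_Cn_def)
qed

lemma A_depth_antimono: "m \<le> n \<Longrightarrow> A_depth T S n \<subseteq> A_depth T S m"
  using funpow_T_increasing[of m n] by (auto simp: A_depth_def)

lemma A_depth_zero: "A_depth T S 0 = S"
  by (auto simp: A_depth_def)

text \<open>The iterates increase, so the least step reaching \<open>s\<close> is a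
  threshold.\<close>

lemma in_funpow_T_iff_Dd: "s \<in> (T ^^ n) B \<longleftrightarrow> Dd T s B \<le> enat n"
proof
  assume "Dd T s B \<le> enat n"
  then have ex: "\<exists>m. s \<in> (T ^^ m) B" and le: "(LEAST m. s \<in> (T ^^ m) B) \<le> n"
    by (auto simp: Dd_def split: if_splits)
  from LeastI_ex[OF ex] funpow_T_increasing[OF le] show "s \<in> (T ^^ n) B" by blast
qed (auto simp: Dd_def intro: Least_le)

text \<open>A redundant \<open>s\<close> lies outside \<open>A\<close>, so \<open>A\<close> is
  contained in \<open>S - {s}\<close>; since \<open>A\<close> derives \<open>s\<close> within
  \<open>n\<close> steps, so does that larger set.\<close>

lemma A_depth_eq_irredundant:
  assumes A: "A = {s \<in> S. s \<notin> Cn (S - {s})}" and depth: "max_depth T S A \<le> enat n"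
  shows "A_depth T S n = A"
proof -
  have "s \<in> (T ^^ n) (S - {s})" if "s \<in> S" "s \<in> Cn (S - {s})" for s
  proof -
    have "Dd T s A \<le> max_depth T S A"
      using that(1) by (auto simp: max_depth_def)
    then have "s \<in> (T ^^ n) A"
      using depth by (auto simp: in_funpow_T_iff_Dd)
    moreover have "A \<subseteq> S - {s}" using that A by auto
    ultimately show ?thesis using funpow_T_mono by blast
  qed
  \<comment> \<open>The other inclusion holds because \<open>Cn\<close> contains every finite
    iterate.\<close>
  then show ?thesis
    unfolding A A_depth_def Cn_eq_Union by blast
qed

lemma R_sem_zero_eq_core_entropy:
  assumes "b > 1" and "set_pmf P \<subseteq> S" and "S \<subseteq> S'"
    and disj: "\<And>s s'. \<lbrakk>s \<in> A_depth T S n; s' \<in> A_depth T S n; s \<noteq> s'\<rbrakk>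
      \<Longrightarrow> R_depth T S S' n s \<inter> R_depth T S S' n s' = {}"
  shows "R_sem b T S S' P 0 n = ereal (core_entropy b P (A_depth T S n))"
  unfolding R_sem_def
proof (rule rate_distortion_zero_eq_core_entropy)
  show "A_depth T S n \<subseteq> S" by (auto simp: A_depth_def)
  then show "d_Cn T S n s s = 0" if "s \<in> A_depth T S n" for s
    using that d_Cn_self by blast
  show "s = s'" if "s \<in> A_depth T S n" "s' \<in> A_depth T S n" "t \<in> S'"
    "d_Cn T S n s t = 0" "d_Cn T S n s' t = 0" for s s' t
    using disj[of s s'] that by (auto simp: R_depth_def)
qed (use assms d_Cn_redundant in \<open>auto simp: d_Cn_def\<close>)

end

theorem mainTheorem6:
  fixes Cn T :: "'s::finite set \<Rightarrow> 's set"
    and xs :: "'s list"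
    and S S' A :: "'s set"
    and P :: "'s pmf"
    and b P\<^sub>A :: real
  assumes "proof_system Cn T"
    and "b > 1"
    and "distinct xs" and "S = set xs"
    and "S' \<noteq> {}"
    and "set_pmf P \<subseteq> S"
    and "A = Atom Cn xs"
    and "P\<^sub>A = measure_pmf.prob P A"
    and "S \<subseteq> S'"
    and "\<forall>\<delta>. \<forall>a\<^sub>1\<in>A_depth T S \<delta>. \<forall>a\<^sub>2\<in>A_depth T S \<delta>.
           a\<^sub>1 \<noteq> a\<^sub>2 \<longrightarrow> R_depth T S S' \<delta> a\<^sub>1 \<inter> R_depth T S S' \<delta> a\<^sub>2 = {}"
    and "A = {s \<in> S. s \<notin> Cn (S - {s})}"
  shows "R_sem b T S S' P 0 0 = ereal (shannon_entropy b P)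
       \<and> (\<forall>\<delta>. max_depth T S A \<le> enat \<delta> \<longrightarrow>
            R_sem b T S S' P 0 \<delta> =
              ereal (if P\<^sub>A = 0 then 0 else P\<^sub>A * shannon_entropy b (cond_pmf P A)))
       \<and> antimono (\<lambda>\<delta>. R_sem b T S S' P 0 \<delta>)"
proof -
  interpret proof_system Cn T by fact
  \<comment> \<open>All three claims now concern the core entropy of
    \<open>A_depth T S \<delta>\<close>: this set is \<open>S\<close> at depth 0, equals
    \<open>A\<close> from the maximal depth on, and shrinks as the depth grows.\<close>
  have R: "R_sem b T S S' P 0 \<delta> = ereal (core_entropy b P (A_depth T S \<delta>))" for \<delta>
    using assms by (intro R_sem_zero_eq_core_entropy) auto
  show ?thesis
  proof (intro conjI allI impI antimonoI)
    show "R_sem b T S S' P 0 0 = ereal (shannon_entropy b P)"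
      unfolding R A_depth_zero core_entropy_full[OF assms(2,6)] ..
    show "R_sem b T S S' P 0 \<delta> =
        ereal (if P\<^sub>A = 0 then 0 else P\<^sub>A * shannon_entropy b (cond_pmf P A))"
      if "max_depth T S A \<le> enat \<delta>" for \<delta>
      unfolding R A_depth_eq_irredundant[OF assms(11) that] core_entropy_eq[OF assms(2)]
        assms(8) ..
    show "R_sem b T S S' P 0 n \<le> R_sem b T S S' P 0 m" if "m \<le> n" for m n
      using core_entropy_mono[OF assms(2) A_depth_antimono[OF that]] by (simp add: R)
  qed
qed

end
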